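(* The cyclic left $\mathbb{O}$-modules are exactly those of type $(n,k)$ with $0\le n,k\le 8$. That is, a left $\mathbb{O}$-module $M$ is generated as a left $\mathbb{O}$-module by a single element if and only if its type is $(n,k)$ for some integers $n,k$ with $0\le n\le 8$ and $0\le k\le 8$.
   Context: $\mathbb{O}$ denotes the real $8$-dimensional division algebra of octonions. A left $\mathbb{O}$-module is a real vector space $M$ with an $\mathbb{R}$-bilinear map $\mathbb{O}\times M\to M$, $(q,m)\mapsto qm$, such that $1m=m$ and $[p,q,m]=-[q,p,m]$ for all $p,q\in\mathbb{O}$, $m\in M$, where $[p,q,m]:=(pq)m-p(qm)$. Submodules are real subspaces closed under the action of $\mathbb{O}$; the submodule generated by an element $m$ is the smallest submodule containing $m$ (it is in general larger than $\mathbb{O}m$). A left $\mathbb{O}$-module is cyclic if it is generated by a single element. Associative elements: $\mathcal{A}(M):=\{m\in M\mid (pq)m-p(qm)=0\ \forall p,q\in\mathbb{O}\}$. Conjugate associative elements: $\mathcal{A}^{-}(M):=\{m\in M\mid (pq)m-q(pm)=0\ \forall p,q\in\mathbb{O}\}$. The type of $M$ is the pair $(\dim_{\mathbb{R}}\mathcal{A}(M),\dim_{\mathbb{R}}\mathcal{A}^{-}(M))$; it is known to determine $M$ up to isomorphism. *)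

theory Defs
  imports "HOL-Analysis.Analysis" "HOL-Library.Extended_Nat"
begin

section \<open>Octonions\<close>

text \<open>
  The octonions are obtained from the complex numbers by two Cayley--Dickson doublings,
  both with the convention $(a,b)(c,d) = (ac - \bar d b,\; da + b\bar c)$ and
  $\overline{(a,b)} = (\bar a, -b)$.  A pair of complex numbers stands for a quaternion.
\<close>

type_synonym quat = "complex \<times> complex"

definition qmul :: "quat \<Rightarrow> quat \<Rightarrow> quat" where
  "qmul x y = (fst x * fst y - cnj (snd y) * snd x, snd y * fst x + snd x * cnj (fst y))"

definition qcnj :: "quat \<Rightarrow> quat" where
  "qcnj x = (cnj (fst x), - snd x)"

datatype octonion = Octonion (oct1: quat) (oct2: quat)

instantiation octonion :: "{real_vector, one, times}"
begin

definition "0 = Octonion 0 0"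
definition "1 = Octonion (1, 0) 0"
definition "x + y = Octonion (oct1 x + oct1 y) (oct2 x + oct2 y)"
definition "x - y = Octonion (oct1 x - oct1 y) (oct2 x - oct2 y)"
definition "- x = Octonion (- oct1 x) (- oct2 x)"
definition "scaleR r x = Octonion (r *\<^sub>R oct1 x) (r *\<^sub>R oct2 x)"
definition "x * y = Octonion
  (qmul (oct1 x) (oct1 y) - qmul (qcnj (oct2 y)) (oct2 x))
  (qmul (oct2 y) (oct1 x) + qmul (oct2 x) (qcnj (oct1 y)))"

instance
  by standard
    (simp_all add: zero_octonion_def plus_octonion_def minus_octonion_def uminus_octonion_def
      scaleR_octonion_def scaleR_add_left scaleR_add_right)

end

lemmas octonion_defs = zero_octonion_def one_octonion_def plus_octonion_def minus_octonion_def
  uminus_octonion_def scaleR_octonion_def times_octonion_def qmul_def qcnj_def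

text \<open>
  By Hurwitz's theorem the following properties (an eight-dimensional real algebra with unit and
  a multiplicative positive definite quadratic form) characterise the octonions up to isomorphism.
\<close>

lemma octonion_mult_one: "1 * x = x" "x * 1 = (x :: octonion)"
  by (simp_all add: octonion_defs zero_prod_def prod_eq_iff octonion.expand)

lemma bilinear_octonion_mult: "bilinear ((*) :: octonion \<Rightarrow> octonion \<Rightarrow> octonion)"
  unfolding bilinear_def
  by (auto intro!: linearI simp: octonion_defs prod_eq_iff algebra_simps)

definition octonion_normsq :: "octonion \<Rightarrow> real" where
  "octonion_normsq x = (norm (oct1 x))\<^sup>2 + (norm (oct2 x))\<^sup>2"

lemma octonion_normsq_eq_0_iff: "octonion_normsq x = 0 \<longleftrightarrow> x = 0"
  by (cases x) (simp add: octonion_normsq_def zero_octonion_def sum_power2_eq_zero_iff)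

lemma octonion_normsq_complex:
  "complex_of_real (octonion_normsq x) =
     fst (oct1 x) * cnj (fst (oct1 x)) + snd (oct1 x) * cnj (snd (oct1 x)) +
     (fst (oct2 x) * cnj (fst (oct2 x)) + snd (oct2 x) * cnj (snd (oct2 x)))"
  by (simp add: octonion_normsq_def norm_prod_def complex_norm_square[symmetric] del: of_real_power)

lemma octonion_normsq_mult: "octonion_normsq (x * y) = octonion_normsq x * octonion_normsq y"
proof -
  have "complex_of_real (octonion_normsq (x * y)) =
        complex_of_real (octonion_normsq x) * complex_of_real (octonion_normsq y)"
    unfolding octonion_normsq_complex by (simp add: octonion_defs algebra_simps)
  then show ?thesis
    by (metis of_real_eq_iff of_real_mult)
qed


section \<open>Left octonion modules\<close>

text \<open>
  A module consists of the whole of a real vector space type \<open>'m\<close> together with an action \<open>act\<close>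
  of the octonions; \<open>act q m\<close> is the product $qm$.
\<close>

definition left_assoc :: "(octonion \<Rightarrow> 'm \<Rightarrow> 'm) \<Rightarrow> octonion \<Rightarrow> octonion \<Rightarrow> 'm \<Rightarrow> 'm::real_vector" where
  "left_assoc act p q m = act (p * q) m - act p (act q m)"

locale left_octonion_module =
  fixes act :: "octonion \<Rightarrow> 'm \<Rightarrow> 'm::real_vector"
  assumes bilinear_act: "bilinear act"
    and act_one: "act 1 m = m"
    and left_assoc_swap: "left_assoc act p q m = - left_assoc act q p m"

lemma left_octonion_module_octonion: "left_octonion_module ((*) :: octonion \<Rightarrow> octonion \<Rightarrow> octonion)"
proof
  show "left_assoc (*) p q m = - left_assoc (*) q p m" for p q m :: octonion
    by (simp add: left_assoc_def octonion_defs prod_eq_iff algebra_simps)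
qed (simp_all add: bilinear_octonion_mult octonion_mult_one)

definition submodule :: "(octonion \<Rightarrow> 'm \<Rightarrow> 'm::real_vector) \<Rightarrow> 'm set \<Rightarrow> bool" where
  "submodule act S \<longleftrightarrow> subspace S \<and> (\<forall>q. \<forall>m\<in>S. act q m \<in> S)"

definition cyclic_module :: "(octonion \<Rightarrow> 'm \<Rightarrow> 'm::real_vector) \<Rightarrow> bool" where
  "cyclic_module act \<longleftrightarrow> (\<exists>m. submodule act hull {m} = UNIV)"

definition assoc_elements :: "(octonion \<Rightarrow> 'm \<Rightarrow> 'm::real_vector) \<Rightarrow> 'm set" where
  "assoc_elements act = {m. \<forall>p q. act (p * q) m - act p (act q m) = 0}"

definition conj_assoc_elements :: "(octonion \<Rightarrow> 'm \<Rightarrow> 'm::real_vector) \<Rightarrow> 'm set" where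
  "conj_assoc_elements act = {m. \<forall>p q. act (p * q) m - act q (act p m) = 0}"

text \<open>
  The constant \<open>dim\<close> returns a junk value on infinite-dimensional subspaces, hence the following
  variant, which is \<open>\<infinity>\<close> there.
\<close>

definition edim :: "'m::real_vector set \<Rightarrow> enat" where
  "edim S = (if \<exists>B. finite B \<and> S \<subseteq> span B then enat (dim S) else \<infinity>)"

definition module_type :: "(octonion \<Rightarrow> 'm \<Rightarrow> 'm::real_vector) \<Rightarrow> enat \<times> enat" where
  "module_type act = (edim (assoc_elements act), edim (conj_assoc_elements act))"

end

theory Submission
  imports Defs
begin

text \<open>
  Write \<open>e\<^sub>0 = 1, e\<^sub>1, \<dots>, e\<^sub>7\<close> for the octonion units, \<open>A\<close> for the associative elements of \<open>M\<close> and \<open>C\<close> for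
  the conjugate associative ones.  Two facts about the structure of \<open>M\<close> carry the proof.

  First, \<open>M\<close> is spanned by the products \<open>q x\<close> with \<open>x\<close> in \<open>A\<close> or \<open>C\<close> (\<open>span_act_assoc_elements\<close>).  The
  imaginary units act as Clifford generators, and each line of the Fano plane, that is, each triple
  with \<open>e\<^sub>i e\<^sub>j = e\<^sub>k\<close>, gives an involution \<open>m \<mapsto> - e\<^sub>i (e\<^sub>j (e\<^sub>k m))\<close>.  These involutions commute, four of them
  generate the others, \<open>A\<close> is their common eigenspace for \<open>1\<close> and \<open>C\<close> the one for \<open>- 1\<close>.  Multiplication
  by a unit changes the signs of a joint eigenvector in a known way, and every one of the \<open>16\<close> sign
  patterns becomes constant after multiplication by a suitable unit.

  Second, the projection \<open>P\<close> onto \<open>A\<close> that the involutions define (\<open>assoc_part\<close>) satisfies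
  \<open>P (q x) = Re q x\<close> for \<open>x\<close> in \<open>A\<close> and \<open>P (q y) = 0\<close> for \<open>y\<close> in \<open>C\<close>, and it preserves submodules.

  If \<open>m\<close> generates \<open>M\<close>, write \<open>m\<close> as \<open>\<Sum> e\<^sub>i a\<^sub>i\<close> plus a sum of products of octonions with
  elements of \<open>C\<close>, with eight elements \<open>a\<^sub>i\<close> of \<open>A\<close>.  All products of octonions with the \<open>a\<^sub>i\<close> and
  with elements of \<open>C\<close> span a submodule that contains \<open>m\<close>, hence \<open>M\<close>, and applying \<open>P\<close> shows that the \<open>a\<^sub>i\<close> span \<open>A\<close> (\<open>assoc_elements_of_cyclic\<close>).
  Conversely, if eight elements \<open>a\<^sub>i\<close> span \<open>A\<close> and eight elements \<open>b\<^sub>i\<close> span \<open>C\<close>, take the sum of all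
  \<open>e\<^sub>i a\<^sub>i\<close> and all \<open>(cnj e\<^sub>i) b\<^sub>i\<close>.  A submodule that contains it contains each \<open>a\<^sub>j\<close>, which is recovered by \<open>P\<close>
  after multiplication by \<open>cnj e\<^sub>j\<close>, and likewise each \<open>b\<^sub>j\<close> (\<open>cyclic_if_assoc_elements\<close>).

  The statements about \<open>C\<close> follow from those about \<open>A\<close> for the action of \<open>cnj q\<close> in place of \<open>q\<close>,
  which is again a module structure and has the same submodules.
\<close>

section \<open>Units and conjugation of octonions\<close>

text \<open>
  Outside the indices \<open>0, \<dots>, 7\<close> the value is \<open>0\<close>, so that the conjugation rule
  holds for every index.
\<close>

definition octonion_unit :: "nat \<Rightarrow> octonion" where
  "octonion_unit i =
    Octonion (Complex (of_bool (i = 0)) (of_bool (i = 1)), Complex (of_bool (i = 2)) (of_bool (i = 3)))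
             (Complex (of_bool (i = 4)) (of_bool (i = 5)), Complex (of_bool (i = 6)) (of_bool (i = 7)))"

definition octonion_Re :: "octonion \<Rightarrow> real" where
  "octonion_Re q = Re (fst (oct1 q))"

definition octonion_cnj :: "octonion \<Rightarrow> octonion" where
  "octonion_cnj q = Octonion (qcnj (oct1 q)) (- oct2 q)"

lemma octonion_eq_iff:
  "p = q \<longleftrightarrow>
    Re (fst (oct1 p)) = Re (fst (oct1 q)) \<and> Im (fst (oct1 p)) = Im (fst (oct1 q)) \<and>
    Re (snd (oct1 p)) = Re (snd (oct1 q)) \<and> Im (snd (oct1 p)) = Im (snd (oct1 q)) \<and>
    Re (fst (oct2 p)) = Re (fst (oct2 q)) \<and> Im (fst (oct2 p)) = Im (fst (oct2 q)) \<and>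
    Re (snd (oct2 p)) = Re (snd (oct2 q)) \<and> Im (snd (oct2 p)) = Im (snd (oct2 q))"
  by (cases p; cases q) (auto simp: prod_eq_iff complex_eq_iff)

lemmas octonion_arith = octonion_defs octonion_Re_def octonion_cnj_def octonion_unit_def
  octonion_eq_iff

lemma less_8_cases:
  "i < (8 :: nat) \<longleftrightarrow> i = 0 \<or> i = 1 \<or> i = 2 \<or> i = 3 \<or> i = 4 \<or> i = 5 \<or> i = 6 \<or> i = 7"
  by auto

lemma octonion_unit_0: "octonion_unit 0 = 1"
  by (simp add: octonion_arith zero_prod_def)

lemma octonion_expansion:
  obtains c where "q = (\<Sum>i<8. c i *\<^sub>R octonion_unit i)" "c 0 = octonion_Re q"
proof
  let ?c = "\<lambda>i. [Re (fst (oct1 q)), Im (fst (oct1 q)), Re (snd (oct1 q)), Im (snd (oct1 q)),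
    Re (fst (oct2 q)), Im (fst (oct2 q)), Re (snd (oct2 q)), Im (snd (oct2 q))] ! i"
  show "q = (\<Sum>i<8. ?c i *\<^sub>R octonion_unit i)"
    by (simp add: octonion_arith numeral_eq_Suc)
  show "?c 0 = octonion_Re q"
    by (simp add: octonion_Re_def)
qed

lemma octonion_unit_anticommute:
  assumes "i < j" "0 < i" "j < 8"
  shows "octonion_unit i * octonion_unit j + octonion_unit j * octonion_unit i = 0"
  using assms by (auto simp: octonion_arith)

lemma octonion_unit_square:
  assumes "0 < i" "i < 8"
  shows "octonion_unit i * octonion_unit i = - 1"
  using assms by (auto simp: less_8_cases octonion_arith)

lemma octonion_cnj_mult: "octonion_cnj (p * q) = octonion_cnj q * octonion_cnj p"
  by (simp add: octonion_arith algebra_simps)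

lemma octonion_cnj_cnj: "octonion_cnj (octonion_cnj q) = q"
  by (simp add: octonion_arith)

lemma octonion_cnj_unit:
  "octonion_cnj (octonion_unit i) = (if i = 0 then 1 else - octonion_unit i)"
  by (auto simp: octonion_arith)

text \<open>
  The form \<open>(p, q) \<mapsto> Re (cnj p * q)\<close> is the inner product for which the units are orthonormal.  It
  extracts one coefficient of an expansion in units by a left multiplication, which is an operation
  that a left module offers.
\<close>

lemma octonion_Re_unit_orthonormal:
  assumes "i < 8" "j < 8"
  shows "octonion_Re (octonion_cnj (octonion_unit i) * octonion_unit j) = of_bool (i = j)"
  using assms by (auto simp: less_8_cases octonion_arith)

lemma linear_octonion_cnj: "linear octonion_cnj"
  by (rule linearI) (simp_all add: octonion_arith)

section \<open>Joint eigenvectors of commuting involutions\<close>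

text \<open>
  Simultaneous diagonalisation: an involution \<open>T\<close> splits \<open>w\<close> as the average of \<open>w + T w\<close> and
  \<open>w - T w\<close>, and both parts stay eigenvectors of every operator that commutes with \<open>T\<close>.
\<close>

lemma span_joint_eigenvectors:
  fixes Ts :: "('m::real_vector \<Rightarrow> 'm) list"
  assumes "\<And>T. T \<in> set Ts \<Longrightarrow> linear T"
    and "\<And>T v. T \<in> set Ts \<Longrightarrow> T (T v) = v"
    and "\<And>S T v. S \<in> set Ts \<Longrightarrow> T \<in> set Ts \<Longrightarrow> S (T v) = T (S v)"
  shows "v \<in> span {w. \<forall>T\<in>set Ts. T w = w \<or> T w = - w}"
  using assms
proof (induction Ts arbitrary: v)
  case Nil
  then show ?case by simp
next
  case (Cons T Ts)
  let ?W = "{w. \<forall>S\<in>set (T # Ts). S w = w \<or> S w = - w}"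
  have lin: "linear S" if "S \<in> set (T # Ts)" for S
    using Cons.prems(1) that by blast
  have comm: "S (T w) = T (S w)" if "S \<in> set Ts" for S w
    using Cons.prems(3) that by simp
  have TT: "T (T w) = w" for w
    using Cons.prems(2) by simp
  have "w \<in> span ?W" if "\<forall>S\<in>set Ts. S w = w \<or> S w = - w" for w
  proof -
    have S: "S (T w) = (if S w = w then T w else - T w)" if "S \<in> set Ts" for S
      using \<open>\<forall>S\<in>set Ts. S w = w \<or> S w = - w\<close> that comm[OF that] lin[of T]
      by (auto simp: linear_neg)
    have "w + T w \<in> ?W" "w - T w \<in> ?W"
      using that lin TT by (auto simp: linear_add linear_diff S)
    then have "(1/2) *\<^sub>R (w + T w) + (1/2) *\<^sub>R (w - T w) \<in> span ?W"
      by (intro span_add span_scale span_base)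
    moreover have "(1/2) *\<^sub>R (w + T w) + (1/2) *\<^sub>R (w - T w) = w"
      by (simp add: scaleR_add_right scaleR_diff_right flip: scaleR_add_left)
    ultimately show ?thesis
      by simp
  qed
  then have "span {w. \<forall>S\<in>set Ts. S w = w \<or> S w = - w} \<subseteq> span ?W"
    by (intro span_minimal subspace_span) auto
  moreover have "v \<in> span {w. \<forall>S\<in>set Ts. S w = w \<or> S w = - w}"
    using Cons.prems by (intro Cons.IH) auto
  ultimately show ?case
    by blast
qed

text \<open>
  For commuting involutions this is the projection onto their common fixed space, along the sum of
  the other joint eigenspaces.  Being a polynomial in the operators, it preserves every subspace
  that they preserve.
\<close>

definition fixed_part :: "('m::real_vector \<Rightarrow> 'm) list \<Rightarrow> 'm \<Rightarrow> 'm" where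
  "fixed_part Ts = foldr (\<lambda>T v. (1/2) *\<^sub>R (v + T v)) Ts"

lemma linear_fixed_part:
  assumes "\<And>T. T \<in> set Ts \<Longrightarrow> linear T"
  shows "linear (fixed_part Ts)"
  using assms
proof (induction Ts)
  case Nil
  then show ?case
    by (simp add: fixed_part_def linear_iff)
next
  case (Cons T Ts)
  then have "linear T" "linear (fixed_part Ts)"
    by simp_all
  then show ?case
    by (simp add: fixed_part_def linear_iff algebra_simps)
qed

lemma fixed_part_fixed:
  assumes "\<And>T. T \<in> set Ts \<Longrightarrow> T w = w"
  shows "fixed_part Ts w = w"
  using assms
proof (induction Ts)
  case (Cons T Ts)
  then have "T w = w" "fixed_part Ts w = w"
    by simp_all
  then show ?case
    by (simp add: fixed_part_def flip: scaleR_2)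
qed (simp add: fixed_part_def)

lemma fixed_part_eq_0:
  assumes "\<And>T. T \<in> set Ts \<Longrightarrow> linear T"
    and "\<And>T. T \<in> set Ts \<Longrightarrow> T w = w \<or> T w = - w"
    and "\<exists>T\<in>set Ts. T w = - w"
  shows "fixed_part Ts w = 0"
  using assms
proof (induction Ts)
  case (Cons T Ts)
  have eq: "fixed_part (T # Ts) w = (1/2) *\<^sub>R (fixed_part Ts w + T (fixed_part Ts w))"
    by (simp add: fixed_part_def)
  show ?case
  proof (cases "\<exists>S\<in>set Ts. S w = - w")
    case True
    then have "fixed_part Ts w = 0"
      using Cons by simp
    then show ?thesis
      using Cons.prems(1)[of T] by (simp add: eq linear_0)
  next
    case False
    then have "fixed_part Ts w = w"
      using Cons.prems(2) by (intro fixed_part_fixed) force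
    moreover have "T w = - w"
      using Cons.prems(3) False by simp
    ultimately show ?thesis
      by (simp add: eq)
  qed
qed simp

section \<open>Bounded dimension\<close>

text \<open>
  The family \<open>a\<close> is a basis padded with zeros, so that exactly \<open>n\<close> slots are available whatever the
  dimension is.  This is the form in which a generator of the module provides or uses the bound.
\<close>

lemma edim_le_iff:
  assumes "subspace S"
  shows "edim S \<le> enat n \<longleftrightarrow> (\<exists>a. range a \<subseteq> S \<and> S \<subseteq> span (a ` {..<n}))"
proof
  assume *: "edim S \<le> enat n"
  then obtain B where B: "finite B" "S \<subseteq> span B" and n: "dim S \<le> n"
    by (auto simp: edim_def split: if_splits)
  obtain C where C: "C \<subseteq> S" "independent C" "S \<subseteq> span C" "card C = dim S"
    using basis_exists .
  have "finite C"
    using independent_span_bound[OF B(1) C(2)] C(1) B(2) by blast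
  then obtain h where h: "bij_betw h {0..<card C} C"
    using ex_bij_betw_nat_finite by blast
  define a where "a i = (if i < card C then h i else 0)" for i
  have "C = h ` {0..<card C}"
    using h by (simp add: bij_betw_def)
  then have "C \<subseteq> a ` {..<n}"
    using n C(4) by (force simp: a_def)
  then have "S \<subseteq> span (a ` {..<n})"
    using C(3) span_mono by blast
  moreover have "range a \<subseteq> S"
    using C(1) bij_betwE[OF h] subspace_0[OF assms] by (auto simp: a_def)
  ultimately show "\<exists>a. range a \<subseteq> S \<and> S \<subseteq> span (a ` {..<n})"
    by blast
next
  assume "\<exists>a. range a \<subseteq> S \<and> S \<subseteq> span (a ` {..<n})"
  then obtain a where a: "S \<subseteq> span (a ` {..<n})"
    by blast
  then have "dim S \<le> card (a ` {..<n})"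
    by (rule dim_le_card) simp
  also have "\<dots> \<le> n"
    using card_image_le[of "{..<n}" a] by simp
  finally show "edim S \<le> enat n"
    using a by (auto simp: edim_def)
qed

section \<open>The conjugate action\<close>

text \<open>
  The octonions are anti-isomorphic to themselves by conjugation.  Twisting the action by it exchanges
  associative and conjugate associative elements and keeps the submodules, so that each statement
  about associative elements yields its conjugate counterpart.
\<close>

definition conj_act :: "(octonion \<Rightarrow> 'm \<Rightarrow> 'm) \<Rightarrow> octonion \<Rightarrow> 'm \<Rightarrow> 'm::real_vector" where
  "conj_act act q = act (octonion_cnj q)"

lemma conj_act_conj_act: "conj_act (conj_act act) = act"
  by (simp add: conj_act_def fun_eq_iff octonion_cnj_cnj)

lemma all_octonion_cnj: "(\<forall>q. P (octonion_cnj q)) \<longleftrightarrow> (\<forall>q. P q)"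
  by (metis octonion_cnj_cnj)

lemma assoc_elements_conj_act: "assoc_elements (conj_act act) = conj_assoc_elements act"
proof -
  have "(\<forall>p q. act (octonion_cnj q * octonion_cnj p) m - act (octonion_cnj p) (act (octonion_cnj q) m) = 0)
    \<longleftrightarrow> (\<forall>p q. act (p * q) m - act q (act p m) = 0)" for m
    unfolding all_octonion_cnj[of "\<lambda>p. \<forall>q. act (octonion_cnj q * p) m - act p (act (octonion_cnj q) m) = 0"]
    unfolding all_octonion_cnj[of "\<lambda>q. act (q * _) m - act _ (act q m) = 0"]
    by (rule all_comm)
  then show ?thesis
    by (simp only: assoc_elements_def conj_assoc_elements_def conj_act_def octonion_cnj_mult)
qed

lemma submodule_conj_act: "submodule (conj_act act) S \<longleftrightarrow> submodule act S"
  unfolding submodule_def conj_act_def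
  using all_octonion_cnj[of "\<lambda>q. \<forall>m\<in>S. act q m \<in> S"] by simp

lemma submodule_hull: "submodule act (submodule act hull X)"
  by (rule hull_in) (auto simp: submodule_def intro: subspace_Inter)

section \<open>Lines of the Fano plane\<close>

text \<open>
  The seven lines of the Fano plane, each oriented so that the product of two cyclically consecutive
  units is the third.
\<close>

definition octonion_lines :: "(nat \<times> nat \<times> nat) set" where
  "octonion_lines = {(1,2,3), (1,4,5), (1,7,6), (2,4,6), (2,5,7), (3,4,7), (3,6,5)}"

lemma octonion_line_mult:
  assumes "(i, j, k) \<in> octonion_lines"
  shows "octonion_unit i * octonion_unit j = octonion_unit k"
    and "octonion_unit j * octonion_unit k = octonion_unit i"
    and "octonion_unit k * octonion_unit i = octonion_unit j"
  using assms by (auto simp: octonion_lines_def) (simp_all add: octonion_arith)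

lemma octonion_lines_range:
  assumes "(i, j, k) \<in> octonion_lines"
  shows "0 < i" "i < 8" "0 < j" "j < 8" "0 < k" "k < 8" "i \<noteq> j" "i \<noteq> k" "j \<noteq> k"
  using assms by (auto simp: octonion_lines_def)

lemma line_through_two_points:
  assumes "0 < i" "i < 8" "0 < j" "j < 8"
  obtains a b c where "(a, b, c) \<in> octonion_lines" "i \<in> {a, b, c}" "j \<in> {a, b, c}"
proof -
  have "\<forall>i\<in>{1,2,3,4,5,6,7}. \<forall>j\<in>{1,2,3,4,5,6,7}.
    \<exists>(a, b, c)\<in>octonion_lines. i \<in> {a, b, c} \<and> j \<in> {a, b, c}"
    by (simp add: octonion_lines_def)
  moreover have "i \<in> {1,2,3,4,5,6,7}" "j \<in> {1,2,3,4,5,6,7}"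
    using assms by auto
  ultimately have "\<exists>(a, b, c)\<in>octonion_lines. i \<in> {a, b, c} \<and> j \<in> {a, b, c}"
    by (metis (no_types, lifting))
  then show ?thesis
    using that by blast
qed

text \<open>
  The first three lines pass through the point \<open>1\<close> and the fourth does not.  The operators of the
  other three lines, defined below, are products of those of these four.
\<close>

definition generating_lines :: "(nat \<times> nat \<times> nat) list" where
  "generating_lines = [(1,2,3), (1,4,5), (1,7,6), (2,4,6)]"

lemma generating_lines_subset: "set generating_lines \<subseteq> octonion_lines"
  by (auto simp: generating_lines_def octonion_lines_def)

text \<open>
  Left multiplication by a unit \<open>e\<^sub>i\<close> keeps the eigenvalue of the operator of a line when \<open>i = 0\<close> or
  \<open>i\<close> lies on the line, and flips it otherwise.  Hence this lemma says that no unit other than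
  \<open>e\<^sub>0 = 1\<close> keeps all four signs, and the next one that no unit flips all four.
\<close>

lemma generating_lines_separate:
  assumes "0 < i" "i < (8 :: nat)"
  shows "\<exists>(a, b, c)\<in>set generating_lines. i \<notin> {0, a, b, c}"
proof -
  have "\<forall>i\<in>{1,2,3,4,5,6,7}. \<exists>(a, b, c)\<in>set generating_lines. i \<notin> {0, a, b, c}"
    by (simp add: generating_lines_def)
  moreover have "i \<in> {1,2,3,4,5,6,7}"
    using assms by auto
  ultimately show ?thesis
    by (rule bspec)
qed

lemma generating_lines_cover:
  assumes "i < (8 :: nat)"
  shows "\<exists>(a, b, c)\<in>set generating_lines. i \<in> {0, a, b, c}"
proof -
  have "\<forall>i\<in>{0,1,2,3,4,5,6,7}. \<exists>(a, b, c)\<in>set generating_lines. i \<in> {0, a, b, c}"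
    by (simp add: generating_lines_def)
  moreover have "i \<in> {0,1,2,3,4,5,6,7}"
    using assms by auto
  ultimately show ?thesis
    by (rule bspec)
qed

text \<open>
  There are \<open>2\<^sup>4\<close> assignments \<open>s\<close> of signs to the four lines, and also \<open>8 \<cdot> 2\<close> patterns that
  a unit \<open>e\<^sub>i\<close> and an overall sign \<open>\<sigma>\<close> produce.  The two lists agree: multiplication by a suitable unit
  makes any assignment of signs constant.
\<close>

lemma sign_pattern_of_unit:
  fixes s :: "nat \<times> nat \<times> nat \<Rightarrow> bool"
  obtains i \<sigma> where "i < 8"
    and "\<forall>(a, b, c)\<in>set generating_lines. (s (a, b, c) \<longleftrightarrow> i \<in> {0, a, b, c}) = \<sigma>"
proof -
  \<comment> \<open>The three lines through \<open>1\<close> cover all points, and every other point lies on exactly one of them.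
    So the product of the three signs of a unit on these lines is \<open>+\<close>, which forces \<open>\<sigma>\<close>.\<close>
  define \<sigma> where "\<sigma> \<longleftrightarrow> (s (1,2,3) \<longleftrightarrow> (s (1,4,5) \<longleftrightarrow> s (1,7,6)))"
  \<comment> \<open>The first two signs determine which of the pairs \<open>{0,1}, {2,3}, {4,5}, {6,7}\<close> contains \<open>i\<close>,
    and the last line, which consists of even points, decides the parity.\<close>
  define i :: nat where "i =
    (if s (1,2,3) = \<sigma> then if s (1,4,5) = \<sigma> then 0 else 2 else if s (1,4,5) = \<sigma> then 4 else 6) +
    (if s (2,4,6) = \<sigma> then 0 else 1)"
  have i: "i \<in> {0,1,2,3} \<longleftrightarrow> s (1,2,3) = \<sigma>" "i \<in> {0,1,4,5} \<longleftrightarrow> s (1,4,5) = \<sigma>"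
    "i \<in> {0,1,7,6} \<longleftrightarrow> (s (1,2,3) = \<sigma>) = (s (1,4,5) = \<sigma>)" "i \<in> {0,2,4,6} \<longleftrightarrow> s (2,4,6) = \<sigma>"
    by (simp_all add: i_def)
  have *: "(s (1,2,3) \<longleftrightarrow> i \<in> {0,1,2,3}) = \<sigma>" "(s (1,4,5) \<longleftrightarrow> i \<in> {0,1,4,5}) = \<sigma>"
    "(s (1,7,6) \<longleftrightarrow> i \<in> {0,1,7,6}) = \<sigma>" "(s (2,4,6) \<longleftrightarrow> i \<in> {0,2,4,6}) = \<sigma>"
    unfolding i unfolding \<sigma>_def by argo+
  show ?thesis
  proof (rule that)
    show "i < 8"
      by (simp add: i_def)
    show "\<forall>(a, b, c)\<in>set generating_lines. (s (a, b, c) \<longleftrightarrow> i \<in> {0, a, b, c}) = \<sigma>"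
      by (simp only: generating_lines_def list.set ball_simps prod.case * simp_thms)
  qed
qed

section \<open>Clifford relations and line operators\<close>

context left_octonion_module
begin

lemmas act_simps =
  bilinear_ladd[OF bilinear_act] bilinear_radd[OF bilinear_act]
  bilinear_lsub[OF bilinear_act] bilinear_rsub[OF bilinear_act]
  bilinear_lneg[OF bilinear_act] bilinear_rneg[OF bilinear_act]
  bilinear_lmul[OF bilinear_act] bilinear_rmul[OF bilinear_act]
  bilinear_lzero[OF bilinear_act] bilinear_rzero[OF bilinear_act] act_one

lemma linear_act: "linear (act q)"
  using bilinear_act by (simp add: bilinear_def)

lemma linear_act_left: "linear (\<lambda>q. act q m)"
  using bilinear_act by (simp add: bilinear_def)

lemma act_act_swap: "act p (act q m) = act (p * q + q * p) m - act q (act p m)"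
  using left_assoc_swap[of p q m] by (simp add: left_assoc_def bilinear_ladd[OF bilinear_act] algebra_simps)

lemma left_assoc_self: "left_assoc act p p m = 0"
proof -
  have "left_assoc act p p m + left_assoc act p p m = 0"
    using left_assoc_swap[of p p m] by (simp only: eq_neg_iff_add_eq_0)
  then have "2 *\<^sub>R left_assoc act p p m = 0"
    by (simp only: scaleR_2)
  then show ?thesis
    by simp
qed

definition unit_act :: "nat \<Rightarrow> 'm \<Rightarrow> 'm" where
  "unit_act i = act (octonion_unit i)"

lemma linear_unit_act: "linear (unit_act i)"
  by (simp add: unit_act_def linear_act)

lemmas unit_act_simps =
  linear_add[OF linear_unit_act] linear_diff[OF linear_unit_act] linear_neg[OF linear_unit_act]
  linear_0[OF linear_unit_act]

lemma unit_act_0 [simp]: "unit_act 0 m = m"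
  by (simp add: unit_act_def octonion_unit_0 act_one)

text \<open>
  Together with the rule \<open>unit_act_swap\<close>, this says that the seven imaginary units act as
  anticommuting generators of a Clifford algebra, which is the alternating law of a module expressed
  on units.
\<close>

lemma unit_act_square:
  assumes "0 < i" "i < 8"
  shows "unit_act i (unit_act i m) = - m"
proof -
  have "unit_act i (unit_act i m) = act (octonion_unit i * octonion_unit i) m"
    using left_assoc_self[of "octonion_unit i" m] unfolding left_assoc_def unit_act_def by simp
  then show ?thesis
    using assms by (simp add: octonion_unit_square act_simps)
qed

lemma unit_act_swap:
  assumes "j < i" "0 < j" "i < 8"
  shows "unit_act i (unit_act j m) = - unit_act j (unit_act i m)"
proof -
  have "octonion_unit i * octonion_unit j + octonion_unit j * octonion_unit i = 0"
    using octonion_unit_anticommute[OF assms] by (simp only: add.commute)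
  then show ?thesis
    unfolding unit_act_def act_act_swap[of "octonion_unit i" "octonion_unit j" m]
    by (simp only: bilinear_lzero[OF bilinear_act] diff_0)
qed

lemmas clifford_simps = unit_act_simps unit_act_square unit_act_swap

text \<open>
  For a line \<open>(i, j, k)\<close> this is \<open>m \<mapsto> (e\<^sub>i e\<^sub>j)\<^sup>-\<^sup>1 (e\<^sub>i (e\<^sub>j m))\<close> up to reordering the three anticommuting
  factors, so that it measures the failure of associativity along the line: it fixes \<open>m\<close> if the line
  associates on \<open>m\<close>.
\<close>

definition line_op :: "nat \<times> nat \<times> nat \<Rightarrow> 'm \<Rightarrow> 'm" where
  "line_op l m = (case l of (i, j, k) \<Rightarrow> - unit_act i (unit_act j (unit_act k m)))"

lemma linear_line_op: "linear (line_op l)"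
  by (cases l) (auto simp: line_op_def linear_iff linear_add[OF linear_unit_act] linear_scale[OF linear_unit_act])

lemma line_op_involution:
  assumes "l \<in> octonion_lines"
  shows "line_op l (line_op l m) = m"
  using assms by (auto simp: octonion_lines_def line_op_def clifford_simps)

text \<open>
  Two distinct lines share one point, so exchanging their words of three anticommuting letters costs
  \<open>9 - 1\<close> sign changes.
\<close>

lemma line_op_commute:
  assumes "l \<in> octonion_lines" "l' \<in> octonion_lines"
  shows "line_op l (line_op l' m) = line_op l' (line_op l m)"
  using assms unfolding octonion_lines_def by (elim insertE emptyE) (simp_all add: line_op_def clifford_simps)

text \<open>
  An imaginary unit on the line passes two anticommuting letters, one off the line passes three.
\<close>

lemma line_op_unit_act:
  assumes "(i, j, k) \<in> octonion_lines" "n < 8"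
  shows "line_op (i, j, k) (unit_act n m) =
    (if n \<in> {0, i, j, k} then unit_act n (line_op (i, j, k) m) else - unit_act n (line_op (i, j, k) m))"
  using assms unfolding octonion_lines_def less_8_cases
  by (elim insertE emptyE disjE) (simp_all add: line_op_def clifford_simps)

lemma line_op_generated:
  "line_op (2,5,7) m = line_op (1,4,5) (line_op (1,7,6) (line_op (2,4,6) m))"
  "line_op (3,4,7) m = line_op (1,2,3) (line_op (1,7,6) (line_op (2,4,6) m))"
  "line_op (3,6,5) m = line_op (1,2,3) (line_op (1,4,5) (line_op (2,4,6) m))"
  by (simp_all add: line_op_def clifford_simps)

lemma line_op_fixed_if_generating:
  assumes "\<forall>l\<in>set generating_lines. line_op l x = x" "l \<in> octonion_lines"
  shows "line_op l x = x"
  using assms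
  by (auto simp: octonion_lines_def line_op_generated[of x] generating_lines_def simp del: One_nat_def)

text \<open>
  Cyclic permutations of three anticommuting letters are even, so \<open>e\<^sub>i (e\<^sub>j (e\<^sub>k x)) = - x\<close> holds for all
  three rotations.  Cancelling the outermost letter gives \<open>e\<^sub>j (e\<^sub>k x) = e\<^sub>i x\<close> and its rotations.
\<close>

lemma left_assoc_eq_0_if_line_op_fixed:
  assumes "(i, j, k) \<in> octonion_lines" "line_op (i, j, k) x = x"
  shows "left_assoc act (octonion_unit i) (octonion_unit j) x = 0"
    and "left_assoc act (octonion_unit j) (octonion_unit k) x = 0"
    and "left_assoc act (octonion_unit k) (octonion_unit i) x = 0"
proof -
  note r = octonion_lines_range[OF assms(1)]
  have x: "unit_act i (unit_act j (unit_act k x)) = - x"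
    using assms(2) unfolding line_op_def by (metis case_prod_conv minus_minus)
  have anti: "unit_act a (unit_act b m) = - unit_act b (unit_act a m)" if "{a, b} \<subseteq> {i, j, k}" "a \<noteq> b" for a b m
    using that r unit_act_swap[of a b m] unit_act_swap[of b a m] by (cases a b rule: linorder_cases) auto
  have jk: "unit_act j (unit_act k x) = unit_act i x"
    using arg_cong[OF x, of "unit_act i"] r by (simp add: unit_act_square unit_act_simps)
  have jki: "unit_act j (unit_act k (unit_act i x)) = - x"
    using x r anti[of i j] anti[of i k] by (simp add: unit_act_simps)
  have ki: "unit_act k (unit_act i x) = unit_act j x"
    using arg_cong[OF jki, of "unit_act j"] r by (simp add: unit_act_square unit_act_simps)
  have kij: "unit_act k (unit_act i (unit_act j x)) = - x"
    using x r anti[of i k] anti[of j k] by (simp add: unit_act_simps)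
  have ij: "unit_act i (unit_act j x) = unit_act k x"
    using arg_cong[OF kij, of "unit_act k"] r by (simp add: unit_act_square unit_act_simps)
  show "left_assoc act (octonion_unit i) (octonion_unit j) x = 0"
    and "left_assoc act (octonion_unit j) (octonion_unit k) x = 0"
    and "left_assoc act (octonion_unit k) (octonion_unit i) x = 0"
    using ij jk ki by (simp_all add: left_assoc_def octonion_line_mult[OF assms(1)] unit_act_def)
qed

section \<open>Associative elements as joint eigenvectors\<close>

text \<open>
  If all line operators fix \<open>x\<close>, then the associator of any two units on \<open>x\<close> vanishes, because two
  distinct imaginary units lie on a common line; bilinearity does the rest.
\<close>

lemma assoc_elements_iff:
  "x \<in> assoc_elements act \<longleftrightarrow> (\<forall>l\<in>set generating_lines. line_op l x = x)"
proof
  assume x: "x \<in> assoc_elements act"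
  then have act: "act p (act q x) = act (p * q) x" for p q
    by (simp add: assoc_elements_def)
  have "line_op (i, j, k) x = x" if l: "(i, j, k) \<in> octonion_lines" for i j k
    using octonion_line_mult(2)[OF l] octonion_lines_range(1,2)[OF l]
    by (simp add: line_op_def unit_act_def act octonion_unit_square act_simps)
  then show "\<forall>l\<in>set generating_lines. line_op l x = x"
    using generating_lines_subset by auto
next
  assume "\<forall>l\<in>set generating_lines. line_op l x = x"
  then have fixed: "line_op l x = x" if "l \<in> octonion_lines" for l
    using that line_op_fixed_if_generating by blast
  have swap: "left_assoc act p q x = 0 \<longleftrightarrow> left_assoc act q p x = 0" for p q
    using left_assoc_swap[of p q x] by simp
  have unit: "left_assoc act (octonion_unit i) (octonion_unit j) x = 0" if "i < 8" "j < 8" for i j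
  proof -
    consider "i = 0" | "j = 0" | "i = j" | "0 < i" "0 < j" "i \<noteq> j"
      by blast
    then show ?thesis
    proof cases
      case 4
      then obtain a b c where l: "(a, b, c) \<in> octonion_lines" "i \<in> {a, b, c}" "j \<in> {a, b, c}"
        using line_through_two_points[of i j] \<open>i < 8\<close> \<open>j < 8\<close> by metis
      note zero = left_assoc_eq_0_if_line_op_fixed[OF l(1) fixed[OF l(1)]]
      show ?thesis
        using l(2,3) \<open>i \<noteq> j\<close> zero zero[THEN swap[THEN iffD1]] by (elim insertE emptyE) simp_all
    next
      case 3
      then show ?thesis
        by (simp only: left_assoc_self)
    qed (simp_all add: octonion_unit_0 left_assoc_def act_one octonion_mult_one)
  qed
  have linear: "linear (\<lambda>p. left_assoc act p q x)" "linear (\<lambda>q. left_assoc act p q x)" for p q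
    by (simp_all add: linear_iff left_assoc_def act_simps bilinear_ladd[OF bilinear_octonion_mult]
      bilinear_radd[OF bilinear_octonion_mult] bilinear_lmul[OF bilinear_octonion_mult]
      bilinear_rmul[OF bilinear_octonion_mult] algebra_simps)
  have "left_assoc act p q x = 0" for p q
  proof -
    obtain b c where "p = (\<Sum>i<8. b i *\<^sub>R octonion_unit i)" "q = (\<Sum>i<8. c i *\<^sub>R octonion_unit i)"
      by (metis octonion_expansion)
    then show ?thesis
      by (simp add: linear_sum[OF linear(1)] linear_sum[OF linear(2)] linear_scale[OF linear(1)]
        linear_scale[OF linear(2)] unit)
  qed
  then show "x \<in> assoc_elements act"
    by (simp add: assoc_elements_def left_assoc_def)
qed

lemma left_octonion_module_conj_act: "left_octonion_module (conj_act act)"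
proof
  show "bilinear (conj_act act)"
    unfolding bilinear_def conj_act_def
    using linear_act linear_compose[OF linear_octonion_cnj linear_act_left] by (simp add: o_def)
  show "conj_act act 1 m = m" for m
    using octonion_cnj_unit[of 0] by (simp add: conj_act_def octonion_unit_0 act_one)
  show "left_assoc (conj_act act) p q m = - left_assoc (conj_act act) q p m" for p q m
    using act_act_swap[of "octonion_cnj p" "octonion_cnj q" m]
    by (simp add: left_assoc_def conj_act_def octonion_cnj_mult act_simps algebra_simps)
qed

interpretation conj: left_octonion_module "conj_act act"
  by (rule left_octonion_module_conj_act)

lemma conj_line_op:
  assumes "l \<in> octonion_lines"
  shows "conj.line_op l m = - line_op l m"
proof -
  have "conj.unit_act n v = - unit_act n v" if "0 < n" for n v
    using that by (simp add: conj.unit_act_def unit_act_def conj_act_def octonion_cnj_unit act_simps)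
  then show ?thesis
    using octonion_lines_range assms by (cases l) (simp add: conj.line_op_def line_op_def unit_act_simps)
qed

text \<open>
  Conjugation negates each of the three imaginary units of a line, hence the operator of the line.
\<close>

lemma conj_assoc_elements_iff:
  "y \<in> conj_assoc_elements act \<longleftrightarrow> (\<forall>l\<in>set generating_lines. line_op l y = - y)"
  unfolding assoc_elements_conj_act[symmetric] conj.assoc_elements_iff
  using generating_lines_subset by (metis conj_line_op minus_equation_iff subsetD)

text \<open>
  Multiplication by the unit of \<open>sign_pattern_of_unit\<close> makes all four eigenvalues equal, and these two
  cases are exactly the associative and the conjugate associative elements.
\<close>

lemma unit_act_joint_eigenvector:
  assumes "\<forall>l\<in>set generating_lines. line_op l w = w \<or> line_op l w = - w"
  obtains i where "i < 8" "unit_act i w \<in> assoc_elements act \<union> conj_assoc_elements act"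
proof -
  obtain i \<sigma> where i: "i < 8"
    and \<sigma>: "\<forall>(a, b, c)\<in>set generating_lines. (line_op (a, b, c) w = w \<longleftrightarrow> i \<in> {0, a, b, c}) = \<sigma>"
    using sign_pattern_of_unit[of "\<lambda>l. line_op l w = w"] .
  have line_op: "line_op l (unit_act i w) = (if \<sigma> then unit_act i w else - unit_act i w)" if l: "l \<in> set generating_lines" for l
  proof -
    obtain a b c where abc: "l = (a, b, c)"
      by (cases l)
    have "l \<in> octonion_lines"
      using l generating_lines_subset by blast
    then have "line_op l (unit_act i w) = (if i \<in> {0, a, b, c} then unit_act i (line_op l w) else - unit_act i (line_op l w))"
      unfolding abc using line_op_unit_act i by blast
    moreover have "line_op l w = (if line_op l w = w then w else - w)"
      using assms l by auto
    moreover have "(line_op l w = w \<longleftrightarrow> i \<in> {0, a, b, c}) = \<sigma>"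
      using bspec[OF \<sigma> l] unfolding abc by (simp only: prod.case)
    ultimately show ?thesis
      using linear_neg[OF linear_unit_act, of i w] by (cases "line_op l w = w"; cases \<sigma>) simp_all
  qed
  have "unit_act i w \<in> assoc_elements act \<union> conj_assoc_elements act"
    unfolding Un_iff assoc_elements_iff conj_assoc_elements_iff by (cases \<sigma>) (simp_all add: line_op)
  with i show ?thesis
    using that by blast
qed

text \<open>
  A joint eigenvector \<open>w\<close> is, up to sign, \<open>e\<^sub>i (e\<^sub>i w)\<close> with \<open>e\<^sub>i w\<close> as in the preceding lemma, and joint eigenvectors
  span the module.
\<close>

lemma span_act_assoc_elements:
  "v \<in> span {act q x |q x. x \<in> assoc_elements act \<union> conj_assoc_elements act}" (is "v \<in> span ?G")
proof -
  have "w \<in> span ?G" if w: "\<forall>l\<in>set generating_lines. line_op l w = w \<or> line_op l w = - w" for w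
  proof -
    obtain i where i: "i < 8" "unit_act i w \<in> assoc_elements act \<union> conj_assoc_elements act"
      using unit_act_joint_eigenvector[OF w] .
    then have "unit_act i (unit_act i w) \<in> span ?G"
      unfolding unit_act_def by (intro span_base) blast
    then show ?thesis
      using i(1) unit_act_square[of i w] span_neg[of "- w" ?G] by (cases "i = 0") simp_all
  qed
  moreover have "v \<in> span {w. \<forall>S\<in>set (map line_op generating_lines). S w = w \<or> S w = - w}"
    by (rule span_joint_eigenvectors) (auto intro: linear_line_op line_op_involution line_op_commute subsetD[OF generating_lines_subset])
  ultimately show ?thesis
    using span_minimal[of "{w. \<forall>S\<in>set (map line_op generating_lines). S w = w \<or> S w = - w}" "span ?G"] by auto
qed

section \<open>Projection onto the associative elements\<close>

text \<open>
  On the octonions themselves, with action by left multiplication, this is the projection to the real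
  part.
\<close>

definition assoc_part :: "'m \<Rightarrow> 'm" where
  "assoc_part = fixed_part (map line_op generating_lines)"

lemma linear_assoc_part: "linear assoc_part"
  unfolding assoc_part_def by (rule linear_fixed_part) (auto simp: linear_line_op)

lemma act_expansion:
  obtains c where "\<And>x. act q x = (\<Sum>i<8. c i *\<^sub>R unit_act i x)" "c 0 = octonion_Re q"
proof -
  obtain c where "q = (\<Sum>i<8. c i *\<^sub>R octonion_unit i)" "c 0 = octonion_Re q"
    by (rule octonion_expansion)
  then show ?thesis
    using that[of c]
    by (simp add: unit_act_def linear_sum[OF linear_act_left] linear_scale[OF linear_act_left])
qed

text \<open>
  The vector \<open>e\<^sub>i x\<close> is a joint eigenvector, and for \<open>i \<noteq> 0\<close> one of the four lines misses \<open>i\<close> and gives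
  it the eigenvalue \<open>- 1\<close>.
\<close>

lemma assoc_part_unit_act_assoc:
  assumes "x \<in> assoc_elements act" "i < 8"
  shows "assoc_part (unit_act i x) = of_bool (i = 0) *\<^sub>R x"
proof -
  have fixed: "line_op l x = x" if "l \<in> set generating_lines" for l
    using assms(1) that assoc_elements_iff by blast
  have line_op: "line_op (a, b, c) (unit_act i x) = (if i \<in> {0, a, b, c} then unit_act i x else - unit_act i x)"
    if "(a, b, c) \<in> set generating_lines" for a b c
    using fixed[OF that] line_op_unit_act[of a b c i x] that generating_lines_subset assms(2) by auto
  show ?thesis
  proof (cases "i = 0")
    case True
    then show ?thesis
      unfolding assoc_part_def using fixed by (subst fixed_part_fixed) auto
  next
    case False
    then obtain a b c where l: "(a, b, c) \<in> set generating_lines" "i \<notin> {0, a, b, c}"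
      using generating_lines_separate assms(2) by blast
    then have "line_op (a, b, c) (unit_act i x) = - unit_act i x"
      using line_op[OF l(1)] by (simp only: if_False)
    with l(1) have "\<exists>S\<in>set (map line_op generating_lines). S (unit_act i x) = - unit_act i x"
      unfolding set_map by blast
    then show ?thesis
      unfolding assoc_part_def using False line_op linear_line_op
      by (subst fixed_part_eq_0) (auto split: if_splits)
  qed
qed

text \<open>
  Here the eigenvalues start out as \<open>- 1\<close>, and one of the four lines keeps that sign.
\<close>

lemma assoc_part_unit_act_conj_assoc:
  assumes "y \<in> conj_assoc_elements act" "i < 8"
  shows "assoc_part (unit_act i y) = 0"
proof -
  have line_op: "line_op (a, b, c) (unit_act i y) = (if i \<in> {0, a, b, c} then - unit_act i y else unit_act i y)"
    if "(a, b, c) \<in> set generating_lines" for a b c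
    using that conj_assoc_elements_iff line_op_unit_act[of a b c i y] generating_lines_subset assms
    by (auto simp: unit_act_simps)
  obtain a b c where l: "(a, b, c) \<in> set generating_lines" "i \<in> {0, a, b, c}"
    using generating_lines_cover assms(2) by blast
  then have "line_op (a, b, c) (unit_act i y) = - unit_act i y"
    using line_op[OF l(1)] by (simp only: if_True)
  with l(1) have "\<exists>S\<in>set (map line_op generating_lines). S (unit_act i y) = - unit_act i y"
    unfolding set_map by blast
  then show ?thesis
    unfolding assoc_part_def using line_op linear_line_op
    by (intro fixed_part_eq_0) (auto split: if_splits)
qed

lemma assoc_part_act_assoc:
  assumes "x \<in> assoc_elements act"
  shows "assoc_part (act q x) = octonion_Re q *\<^sub>R x"
proof -
  obtain c where c: "\<And>x. act q x = (\<Sum>i<8. c i *\<^sub>R unit_act i x)" "c 0 = octonion_Re q"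
    by (rule act_expansion[of q]) blast
  have "assoc_part (act q x) = (\<Sum>i<8. if i = 0 then c i *\<^sub>R x else 0)"
    unfolding c(1) linear_sum[OF linear_assoc_part]
    by (intro sum.cong) (simp_all add: linear_scale[OF linear_assoc_part] assoc_part_unit_act_assoc[OF assms])
  then show ?thesis
    by (simp add: c(2))
qed

lemma assoc_part_act_conj_assoc:
  assumes "y \<in> conj_assoc_elements act"
  shows "assoc_part (act q y) = 0"
proof -
  obtain c where c: "\<And>x. act q x = (\<Sum>i<8. c i *\<^sub>R unit_act i x)"
    by (rule act_expansion[of q]) blast
  show ?thesis
    unfolding c linear_sum[OF linear_assoc_part]
    by (simp add: linear_scale[OF linear_assoc_part] assoc_part_unit_act_conj_assoc[OF assms])
qed

lemma assoc_part_in_submodule: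
  assumes "submodule act N" "m \<in> N"
  shows "assoc_part m \<in> N"
proof -
  have "fixed_part (map line_op ls) m \<in> N" for ls
  proof (induction ls)
    case (Cons l ls)
    have N: "subspace N" "unit_act i v \<in> N" if "v \<in> N" for i v
      using assms(1) that by (auto simp: submodule_def unit_act_def)
    then have "line_op l v \<in> N" if "v \<in> N" for v
      using that by (auto simp: line_op_def subspace_neg split: prod.split)
    with Cons show ?case
      using N(1) by (simp add: fixed_part_def subspace_scale subspace_add)
  qed (simp add: fixed_part_def assms)
  then show ?thesis
    by (simp add: assoc_part_def)
qed

lemma act_act_assoc: "x \<in> assoc_elements act \<Longrightarrow> act p (act q x) = act (p * q) x"
  by (simp add: assoc_elements_def)

lemma act_act_conj_assoc: "y \<in> conj_assoc_elements act \<Longrightarrow> act p (act q y) = act (q * p) y"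
  by (simp add: conj_assoc_elements_def)

lemma subspace_assoc_elements: "subspace (assoc_elements act)"
  unfolding subspace_def
  by (simp add: assoc_elements_iff linear_0[OF linear_line_op] linear_add[OF linear_line_op] linear_scale[OF linear_line_op])

section \<open>Cyclic modules\<close>

text \<open>
  Since associative elements form a subspace and an octonion has eight coordinates, eight associative
  elements suffice for each \<open>m\<close>, however many terms its expansion has.  This is the source of the
  bound \<open>8\<close>.
\<close>

lemma expansion_mod_conj_assoc:
  obtains x where "range x \<subseteq> assoc_elements act"
    and "m - (\<Sum>i<8. unit_act i (x i)) \<in> span {act q y |q y. y \<in> conj_assoc_elements act}"
proof -
  let ?A = "assoc_elements act" and ?W = "span {act q y |q y. y \<in> conj_assoc_elements act}"
  note A = subspace_assoc_elements
  have "\<exists>x. range x \<subseteq> ?A \<and> m - (\<Sum>i<8. unit_act i (x i)) \<in> ?W"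
    using span_act_assoc_elements[of m]
  proof (induction rule: span_induct)
    case base
    show ?case
      unfolding subspace_def mem_Collect_eq
    proof safe
      show "\<exists>x. range x \<subseteq> ?A \<and> 0 - (\<Sum>i<8. unit_act i (x i)) \<in> ?W"
        using subspace_0[OF A] by (intro exI[of _ "\<lambda>_. 0"]) (auto simp: unit_act_simps span_zero)
    next
      fix v w x y
      assume v: "range x \<subseteq> ?A" "v - (\<Sum>i<8. unit_act i (x i)) \<in> ?W"
        and w: "range y \<subseteq> ?A" "w - (\<Sum>i<8. unit_act i (y i)) \<in> ?W"
      have "v + w - (\<Sum>i<8. unit_act i (x i + y i)) = (v - (\<Sum>i<8. unit_act i (x i))) + (w - (\<Sum>i<8. unit_act i (y i)))"
        by (simp add: unit_act_simps sum.distrib)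
      then have "v + w - (\<Sum>i<8. unit_act i (x i + y i)) \<in> ?W"
        using span_add[OF v(2) w(2)] by (simp only:)
      moreover have "range (\<lambda>i. x i + y i) \<subseteq> ?A"
        using v(1) w(1) subspace_add[OF A] by blast
      ultimately show "\<exists>z. range z \<subseteq> ?A \<and> v + w - (\<Sum>i<8. unit_act i (z i)) \<in> ?W"
        by blast
    next
      fix c :: real and v x
      assume v: "range x \<subseteq> ?A" "v - (\<Sum>i<8. unit_act i (x i)) \<in> ?W"
      have "c *\<^sub>R v - (\<Sum>i<8. unit_act i (c *\<^sub>R x i)) = c *\<^sub>R (v - (\<Sum>i<8. unit_act i (x i)))"
        by (simp add: linear_scale[OF linear_unit_act] scaleR_diff_right scaleR_sum_right)
      then have "c *\<^sub>R v - (\<Sum>i<8. unit_act i (c *\<^sub>R x i)) \<in> ?W"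
        using span_scale[OF v(2)] by (simp only:)
      moreover have "range (\<lambda>i. c *\<^sub>R x i) \<subseteq> ?A"
        using v(1) subspace_scale[OF A] by blast
      ultimately show "\<exists>z. range z \<subseteq> ?A \<and> c *\<^sub>R v - (\<Sum>i<8. unit_act i (z i)) \<in> ?W"
        by blast
    qed
  next
    case (step v)
    then obtain q x where v: "v = act q x" and x: "x \<in> ?A \<or> x \<in> conj_assoc_elements act"
      by blast
    show ?case
    proof (cases "x \<in> ?A")
      case True
      obtain c where c: "\<And>x. act q x = (\<Sum>i<8. c i *\<^sub>R unit_act i x)"
        by (rule act_expansion[of q]) blast
      have "v - (\<Sum>i<8. unit_act i (c i *\<^sub>R x)) \<in> ?W"
        by (simp add: v c linear_scale[OF linear_unit_act] span_zero)
      moreover have "range (\<lambda>i. c i *\<^sub>R x) \<subseteq> ?A"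
        using True subspace_scale[OF A] by blast
      ultimately show ?thesis
        by (intro exI[of _ "\<lambda>i. c i *\<^sub>R x"]) blast
    next
      case False
      then have "v \<in> ?W"
        using x v by (intro span_base) blast
      then show ?thesis
        using subspace_0[OF A] by (intro exI[of _ "\<lambda>_. 0"]) (auto simp: unit_act_simps)
    qed
  qed
  then show ?thesis
    using that by blast
qed

text \<open>
  Octonions acting successively on an element of \<open>X\<close> can be merged into one, by
  \<open>p (q x) = (p q) x\<close> or \<open>p (q x) = (q p) x\<close>; no further elements arise.
\<close>

lemma submodule_span_act:
  assumes "X \<subseteq> assoc_elements act \<union> conj_assoc_elements act"
  shows "submodule act (span {act q x |q x. x \<in> X})"
  unfolding submodule_def
proof (intro conjI allI ballI subspace_span)
  fix p m
  let ?G = "{act q x |q x. x \<in> X}"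
  assume "m \<in> span ?G"
  then have "act p m \<in> span (act p ` ?G)"
    using linear_span_image[OF linear_act] by blast
  moreover have "act p ` ?G \<subseteq> ?G"
    using assms act_act_assoc act_act_conj_assoc by blast
  ultimately show "act p m \<in> span ?G"
    using span_mono by blast
qed

text \<open>
  A generator \<open>m\<close> involves only eight associative elements \<open>a\<^sub>i\<close>.  These and the conjugate associative
  elements already generate a submodule containing \<open>m\<close>, hence everything.  Applying the projection
  \<open>assoc_part\<close> to the whole module shows that the \<open>a\<^sub>i\<close> span the associative elements.
\<close>

lemma assoc_elements_of_cyclic:
  assumes "cyclic_module act"
  shows "\<exists>a :: nat \<Rightarrow> 'm. range a \<subseteq> assoc_elements act \<and> assoc_elements act \<subseteq> span (a ` {..<8})"
proof -
  obtain m where m: "submodule act hull {m} = UNIV"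
    using assms by (auto simp: cyclic_module_def)
  obtain a where a: "range a \<subseteq> assoc_elements act"
    "m - (\<Sum>i<8. unit_act i (a i)) \<in> span {act q y |q y. y \<in> conj_assoc_elements act}" (is "_ \<in> span ?C")
    by (rule expansion_mod_conj_assoc)
  let ?G = "{act q x |q x. x \<in> a ` {..<8} \<union> conj_assoc_elements act}"
  have "?C \<subseteq> ?G"
    by blast
  then have "m - (\<Sum>i<8. unit_act i (a i)) \<in> span ?G"
    using a(2) span_mono by blast
  moreover have "(\<Sum>i<8. unit_act i (a i)) \<in> span ?G"
    unfolding unit_act_def by (intro span_sum span_base) blast
  ultimately have "m \<in> span ?G"
    using span_add by fastforce
  moreover have "submodule act (span ?G)"
    using a(1) by (intro submodule_span_act) blast
  ultimately have "submodule act hull {m} \<subseteq> span ?G"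
    by (intro hull_minimal) simp_all
  then have G: "span ?G = UNIV"
    using m by blast
  have "assoc_part (act q x) \<in> span (a ` {..<8})" if "x \<in> a ` {..<8} \<union> conj_assoc_elements act" for q x
    using that
  proof
    assume x: "x \<in> a ` {..<8}"
    then have "assoc_part (act q x) = octonion_Re q *\<^sub>R x"
      using a(1) by (intro assoc_part_act_assoc) blast
    then show ?thesis
      using x by (simp add: span_scale span_base)
  next
    assume "x \<in> conj_assoc_elements act"
    then show ?thesis
      by (simp add: assoc_part_act_conj_assoc span_zero)
  qed
  then have "assoc_part ` ?G \<subseteq> span (a ` {..<8})"
    by blast
  then have "span (assoc_part ` ?G) \<subseteq> span (a ` {..<8})"
    by (intro span_minimal subspace_span)
  then have range: "range assoc_part \<subseteq> span (a ` {..<8})"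
    unfolding linear_span_image[OF linear_assoc_part] G .
  have "x \<in> span (a ` {..<8})" if "x \<in> assoc_elements act" for x
  proof -
    have "assoc_part x = x"
      using assoc_part_unit_act_assoc[OF that, of 0] by simp
    then show ?thesis
      using range by (metis rangeI subsetD)
  qed
  then show ?thesis
    using a(1) by blast
qed

text \<open>
  Multiplying by the conjugate of \<open>e\<^sub>j\<close> turns the coefficient of \<open>a\<^sub>i\<close> into an octonion whose real part is
  \<open>1\<close> for \<open>i = j\<close> and \<open>0\<close> otherwise, and \<open>assoc_part\<close> reads off that real part and kills the second sum.
  The conjugates in the second sum make the element symmetric under \<open>conj_act\<close>.
\<close>

lemma assoc_component_in_submodule:
  fixes a b :: "nat \<Rightarrow> 'm"
  assumes "submodule act N" "range a \<subseteq> assoc_elements act" "range b \<subseteq> conj_assoc_elements act"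
    and "(\<Sum>i<8. act (octonion_unit i) (a i)) + (\<Sum>i<8. act (octonion_cnj (octonion_unit i)) (b i)) \<in> N"
      (is "?m \<in> N")
    and "j < 8"
  shows "a j \<in> N"
proof -
  let ?q = "octonion_cnj (octonion_unit j)"
  have "assoc_part (act ?q (act (octonion_unit i) (a i))) = (if j = i then a i else 0)" if "i < 8" for i
    using assms(2,5) that
    by (simp add: act_act_assoc assoc_part_act_assoc octonion_Re_unit_orthonormal range_subsetD)
  moreover have "assoc_part (act ?q (act p (b i))) = 0" for i p
    using assms(3) by (simp add: act_act_conj_assoc assoc_part_act_conj_assoc range_subsetD)
  ultimately have "assoc_part (act ?q ?m) = a j"
    using assms(5)
    by (simp add: linear_add[OF linear_act] linear_sum[OF linear_act]
      linear_add[OF linear_assoc_part] linear_sum[OF linear_assoc_part])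
  moreover have "act ?q ?m \<in> N"
    using assms(1,4) by (simp add: submodule_def)
  ultimately show ?thesis
    using assoc_part_in_submodule[OF assms(1)] by metis
qed

text \<open>
  The generator attaches a different unit to each of the spanning elements, so that the submodule it
  generates can tell them apart.
\<close>

lemma cyclic_if_assoc_elements:
  fixes a b :: "nat \<Rightarrow> 'm"
  assumes a: "range a \<subseteq> assoc_elements act" "assoc_elements act \<subseteq> span (a ` {..<8})"
    and b: "range b \<subseteq> conj_assoc_elements act" "conj_assoc_elements act \<subseteq> span (b ` {..<8})"
  shows "cyclic_module act"
proof -
  define m where "m = (\<Sum>i<8. act (octonion_unit i) (a i)) +
    (\<Sum>i<8. act (octonion_cnj (octonion_unit i)) (b i))"
  define N where "N = submodule act hull {m}"
  have N: "submodule act N" and m: "m \<in> N"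
    unfolding N_def by (rule submodule_hull, simp add: hull_inc)
  have "subspace N"
    using N by (simp add: submodule_def)
  have "a j \<in> N" if "j < 8" for j
    using assoc_component_in_submodule[OF N a(1) b(1) _ that] m by (simp only: m_def)
  then have A: "assoc_elements act \<subseteq> N"
    using a(2) span_minimal[OF _ \<open>subspace N\<close>, of "a ` {..<8}"] by blast
  \<comment> \<open>For the twisted action the same element \<open>m\<close> has the two sums exchanged.\<close>
  have "conj_assoc_elements (conj_act act) = assoc_elements act"
    using assoc_elements_conj_act[of "conj_act act"] by (simp only: conj_act_conj_act)
  moreover have "m = (\<Sum>i<8. conj_act act (octonion_unit i) (b i)) +
    (\<Sum>i<8. conj_act act (octonion_cnj (octonion_unit i)) (a i))"
    by (simp add: m_def conj_act_def octonion_cnj_cnj add.commute)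
  ultimately have "b j \<in> N" if "j < 8" for j
    using left_octonion_module.assoc_component_in_submodule[OF left_octonion_module_conj_act, of N b a j]
      N a(1) b(1) m that
    by (simp only: submodule_conj_act assoc_elements_conj_act)
  then have "conj_assoc_elements act \<subseteq> N"
    using b(2) span_minimal[OF _ \<open>subspace N\<close>, of "b ` {..<8}"] by blast
  with A have "{act q x |q x. x \<in> assoc_elements act \<union> conj_assoc_elements act} \<subseteq> N"
    using N by (auto simp: submodule_def)
  then have "v \<in> N" for v
    using span_minimal[OF _ \<open>subspace N\<close>] span_act_assoc_elements by blast
  then show ?thesis
    unfolding cyclic_module_def N_def by blast
qed

end

theorem corollary3p6:
  fixes act :: "octonion \<Rightarrow> 'm \<Rightarrow> 'm::real_vector"
  assumes "left_octonion_module act"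
  shows "cyclic_module act \<longleftrightarrow>
    (\<exists>n k :: nat. n \<le> 8 \<and> k \<le> 8 \<and> module_type act = (enat n, enat k))"
proof -
  interpret M: left_octonion_module act
    by (rule assms)
  interpret M': left_octonion_module "conj_act act"
    by (rule M.left_octonion_module_conj_act)
  let ?A = "assoc_elements act" and ?C = "conj_assoc_elements act"
  have subspace: "subspace ?A" "subspace ?C"
    using M.subspace_assoc_elements M'.subspace_assoc_elements
    by (simp_all only: assoc_elements_conj_act)
  have "cyclic_module (conj_act act) \<longleftrightarrow> cyclic_module act"
    by (simp add: cyclic_module_def hull_def submodule_conj_act)
  then have "cyclic_module act \<longleftrightarrow>
    (\<exists>a :: nat \<Rightarrow> 'm. range a \<subseteq> ?A \<and> ?A \<subseteq> span (a ` {..<8})) \<and>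
    (\<exists>b :: nat \<Rightarrow> 'm. range b \<subseteq> ?C \<and> ?C \<subseteq> span (b ` {..<8}))"
    using M.assoc_elements_of_cyclic M'.assoc_elements_of_cyclic[unfolded assoc_elements_conj_act]
      M.cyclic_if_assoc_elements by metis
  also have "\<dots> \<longleftrightarrow> edim ?A \<le> enat 8 \<and> edim ?C \<le> enat 8"
    by (simp only: edim_le_iff[OF subspace(1)] edim_le_iff[OF subspace(2)])
  also have "\<dots> \<longleftrightarrow> (\<exists>n k :: nat. n \<le> 8 \<and> k \<le> 8 \<and> module_type act = (enat n, enat k))"
    by (cases "edim ?A"; cases "edim ?C") (simp_all add: module_type_def)
  finally show ?thesis .
qed

end
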